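(* Let $\alpha$ be a Frenet curve in $E^3$ with Frenet frame $\{T,N,B\}$, curvature $\kappa$ and torsion $\tau$, and let $\beta$ be a Bertrand-direction curve of $\alpha$ with curvature $\overline\kappa$ and torsion $\overline\tau$. Let $\theta$ be the constant (determined modulo $2\pi$) for which $\beta'=\cos\theta\,T+\sin\theta\,B$. Then $$\overline\kappa=|\kappa\cos\theta-\tau\sin\theta|,\qquad \overline\tau=\kappa\sin\theta+\tau\cos\theta,$$ $$\kappa=|\overline\kappa\cos\theta+\overline\tau\sin\theta|,\qquad \tau=\overline\tau\cos\theta-\overline\kappa\sin\theta.$$
   Context: $I\subset\mathbb{R}$ is an open interval and curves are smooth. A unit speed curve $\alpha:I\to E^3$ is a Frenet curve if its curvature $\kappa=\|\alpha''\|$ is nowhere zero; then $T=\alpha'$, $N=\alpha''/\kappa$, $B=T\times N$, and $T'=\kappa N$, $N'=-\kappa T+\tau B$, $B'=-\tau N$, where $\tau$ is the torsion. For a unit vector field $X(s)=a(s)T(s)+b(s)N(s)+c(s)B(s)$ with $a,b,c$ smooth and $a^2+b^2+c^2=1$, an $X$-direction curve of $\alpha$ is a curve $\beta:I\to E^3$ with $\beta'(s)=X(s)$; the parameter $s$ is then also arc length for $\beta$. The Frenet apparatus of $\beta$ is defined in the same way and denoted $\{\overline T,\overline N,\overline B\},\overline\kappa,\overline\tau$. An $X$-direction curve $\beta$ of $\alpha$ (for some such $X$) is called a Bertrand-direction curve of $\alpha$ if $\beta$ is a Bertrand curve of $\alpha$ (and $\alpha$ a Bertrand partner curve of $\beta$),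 in the sense that $\beta$ is a Frenet curve with $\overline N=N$ at each common parameter value $s$. In that case $\beta'=\cos\theta\,T+\sin\theta\,B$ for some constant $\theta\in\mathbb{R}$, the constant oriented angle between the tangent lines of the curves. *)

theory Defs
  imports "HOL-Analysis.Analysis"
begin

text \<open>
  Curves are total functions on the reals, but only their restriction to an open interval \<open>I\<close>
  is meant: since \<open>I\<close> is open, all derivatives at points of \<open>I\<close> are determined by that restriction.
\<close>

definition vderiv :: "(real \<Rightarrow> 'a::real_normed_vector) \<Rightarrow> real \<Rightarrow> 'a" where
  "vderiv f s = vector_derivative f (at s)"

definition smooth_on :: "real set \<Rightarrow> (real \<Rightarrow> 'a::real_normed_vector) \<Rightarrow> bool" where
  "smooth_on I f \<longleftrightarrow> (\<forall>n. (vderiv ^^ n) f differentiable_on I)"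

text \<open>The Frenet apparatus of a curve parametrised by arc length.\<close>

definition tangent :: "(real \<Rightarrow> real^3) \<Rightarrow> real \<Rightarrow> real^3" where
  "tangent \<alpha> s = vderiv \<alpha> s"

definition curvature :: "(real \<Rightarrow> real^3) \<Rightarrow> real \<Rightarrow> real" where
  "curvature \<alpha> s = norm (vderiv (vderiv \<alpha>) s)"

definition normal :: "(real \<Rightarrow> real^3) \<Rightarrow> real \<Rightarrow> real^3" where
  "normal \<alpha> s = vderiv (vderiv \<alpha>) s /\<^sub>R curvature \<alpha> s"

definition binormal :: "(real \<Rightarrow> real^3) \<Rightarrow> real \<Rightarrow> real^3" where
  "binormal \<alpha> s = cross3 (tangent \<alpha> s) (normal \<alpha> s)"

text \<open>
  The torsion is the coefficient \<open>\<tau>\<close> in the Frenet equation \<open>B' = - \<tau> N\<close>;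
  as \<open>N\<close> is a unit vector, it is read off by taking the inner product with \<open>N\<close>.
\<close>

definition torsion :: "(real \<Rightarrow> real^3) \<Rightarrow> real \<Rightarrow> real" where
  "torsion \<alpha> s = - (vderiv (binormal \<alpha>) s \<bullet> normal \<alpha> s)"

definition frenet_curve :: "real set \<Rightarrow> (real \<Rightarrow> real^3) \<Rightarrow> bool" where
  "frenet_curve I \<alpha> \<longleftrightarrow>
     smooth_on I \<alpha> \<and>
     (\<forall>s\<in>I. norm (vderiv \<alpha> s) = 1) \<and>
     (\<forall>s\<in>I. curvature \<alpha> s \<noteq> 0)"

definition unit_frame_field ::
    "real set \<Rightarrow> (real \<Rightarrow> real^3) \<Rightarrow> (real \<Rightarrow> real^3) \<Rightarrow> bool" where
  "unit_frame_field I \<alpha> X \<longleftrightarrow>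
     (\<exists>a b c. smooth_on I a \<and> smooth_on I b \<and> smooth_on I c \<and>
        (\<forall>s\<in>I. (a s)\<^sup>2 + (b s)\<^sup>2 + (c s)\<^sup>2 = 1) \<and>
        (\<forall>s\<in>I. X s = a s *\<^sub>R tangent \<alpha> s + b s *\<^sub>R normal \<alpha> s + c s *\<^sub>R binormal \<alpha> s))"

definition direction_curve ::
    "real set \<Rightarrow> (real \<Rightarrow> real^3) \<Rightarrow> (real \<Rightarrow> real^3) \<Rightarrow> (real \<Rightarrow> real^3) \<Rightarrow> bool" where
  "direction_curve I \<alpha> X \<beta> \<longleftrightarrow>
     unit_frame_field I \<alpha> X \<and> (\<forall>s\<in>I. (\<beta> has_vector_derivative X s) (at s))"

definition bertrand_curve_of ::
    "real set \<Rightarrow> (real \<Rightarrow> real^3) \<Rightarrow> (real \<Rightarrow> real^3) \<Rightarrow> bool" where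
  "bertrand_curve_of I \<alpha> \<beta> \<longleftrightarrow> frenet_curve I \<beta> \<and> (\<forall>s\<in>I. normal \<beta> s = normal \<alpha> s)"

definition bertrand_direction_curve ::
    "real set \<Rightarrow> (real \<Rightarrow> real^3) \<Rightarrow> (real \<Rightarrow> real^3) \<Rightarrow> bool" where
  "bertrand_direction_curve I \<alpha> \<beta> \<longleftrightarrow>
     (\<exists>X. direction_curve I \<alpha> X \<beta>) \<and> bertrand_curve_of I \<alpha> \<beta>"

definition direction_angle ::
    "real set \<Rightarrow> (real \<Rightarrow> real^3) \<Rightarrow> (real \<Rightarrow> real^3) \<Rightarrow> real \<Rightarrow> bool" where
  "direction_angle I \<alpha> \<beta> \<theta> \<longleftrightarrow>
     (\<forall>s\<in>I. vderiv \<beta> s = cos \<theta> *\<^sub>R tangent \<alpha> s + sin \<theta> *\<^sub>R binormal \<alpha> s)"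

end

theory Submission
  imports Defs
begin

text \<open>
  Both curves have the same principal normal \<open>N\<close>, so \<open>\<beta>'\<close>, being orthogonal to it, lies in the
  rectifying plane spanned by \<open>T\<close> and \<open>B\<close>. Its components in that plane are constant: the
  derivatives of \<open>T\<close>, \<open>B\<close> and \<open>\<beta>'\<close> are all multiples of \<open>N\<close>, which is orthogonal to all three, so
  that the derivatives of \<open>\<beta>' \<bullet> T\<close> and \<open>\<beta>' \<bullet> B\<close> vanish. Being the components of a unit vector,
  they are \<open>cos \<theta>\<close> and \<open>sin \<theta>\<close> for one angle \<open>\<theta>\<close>, unique modulo \<open>2\<pi>\<close>
  (lemmas \<open>common_normal_imp_direction_angle\<close> and \<open>direction_angle_unique\<close>).

  Differentiating \<open>\<beta>' = cos \<theta> T + sin \<theta> B\<close> and the resulting formula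
  \<open>cos \<theta> B - sin \<theta> T\<close> for the binormal of \<open>\<beta>\<close>, and comparing with the Frenet equations of \<open>\<beta>\<close>, shows
  that the pair (curvature, torsion) of \<open>\<beta>\<close> is that of \<open>\<alpha>\<close> rotated by \<open>\<theta>\<close>
  (lemma \<open>common_normal_curvature_torsion\<close>). The rotation
  inverts to the formulas for \<open>\<alpha>\<close>. No sign ambiguity arises: equality of the normals,
  and not just of their lines, fixes the sign of each expression whose absolute value is taken.
\<close>

section \<open>Orthonormal frames in three-space\<close>

lemma cross3_orthonormal:
  fixes t n :: "real^3"
  assumes t: "norm t = 1" and n: "norm n = 1" and tn: "t \<bullet> n = 0"
  shows "norm (cross3 t n) = 1" and "cross3 (cross3 t n) n = - t"
proof -
  have "(norm (cross3 t n))\<^sup>2 = 1"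
    by (simp add: norm_cross t n tn)
  then show "norm (cross3 t n) = 1"
    by (simp add: power2_eq_1_iff) (metis norm_ge_zero neg_0_le_iff_le not_one_le_zero)
  have "cross3 n (cross3 t n) = (n \<bullet> n) *\<^sub>R t - (n \<bullet> t) *\<^sub>R n"
    by (rule Lagrange)
  also have "\<dots> = t"
    using n tn by (simp add: inner_commute dot_square_norm)
  finally show "cross3 (cross3 t n) n = - t"
    by (subst cross_skew) simp
qed

text \<open>
  The difference of the two sides is orthogonal to \<open>t\<close>, \<open>n\<close> and \<open>cross3 t n\<close>. Being orthogonal to
  \<open>t\<close> and \<open>n\<close>, it is parallel to \<open>cross3 t n\<close>; being orthogonal to \<open>cross3 t n\<close> as well, it is zero.
\<close>

lemma orthonormal_frame_expansion:
  fixes t n v :: "real^3"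
  assumes t: "norm t = 1" and n: "norm n = 1" and tn: "t \<bullet> n = 0"
  shows "v = (v \<bullet> t) *\<^sub>R t + (v \<bullet> n) *\<^sub>R n + (v \<bullet> cross3 t n) *\<^sub>R cross3 t n"
proof -
  let ?b = "cross3 t n"
  define w where "w = v - ((v \<bullet> t) *\<^sub>R t + (v \<bullet> n) *\<^sub>R n + (v \<bullet> ?b) *\<^sub>R ?b)"
  have b: "norm ?b = 1"
    by (rule cross3_orthonormal(1)[OF t n tn])
  have ips: "t \<bullet> t = 1" "n \<bullet> n = 1" "?b \<bullet> ?b = 1" "n \<bullet> t = 0" "?b \<bullet> t = 0" "?b \<bullet> n = 0"
      "t \<bullet> ?b = 0" "n \<bullet> ?b = 0"
    using t n b tn by (simp_all add: dot_square_norm dot_cross_self inner_commute)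
  have w: "w \<bullet> t = 0" "w \<bullet> n = 0" "w \<bullet> ?b = 0"
    unfolding w_def by (simp_all add: inner_diff_left inner_add_left ips tn)
  have "cross3 w ?b = 0"
    by (simp add: Lagrange w)
  then have "w = 0"
    using norm_cross[of w ?b] b w by simp
  then show ?thesis
    by (simp add: w_def)
qed

section \<open>The Frenet equations\<close>

lemma inner_constant_derivative:
  fixes f g :: "real \<Rightarrow> 'a::real_inner"
  assumes "open I" "s \<in> I" "\<And>x. x \<in> I \<Longrightarrow> f x \<bullet> g x = c"
    and f: "(f has_vector_derivative f') (at s)" and g: "(g has_vector_derivative g') (at s)"
  shows "f s \<bullet> g' + f' \<bullet> g s = 0"
proof -
  have "((\<lambda>x. f x \<bullet> g x) has_vector_derivative (f s \<bullet> g' + f' \<bullet> g s)) (at s)"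
    by (rule bounded_bilinear.has_vector_derivative[OF bounded_bilinear_inner f g])
  moreover have "((\<lambda>x. f x \<bullet> g x) has_vector_derivative 0) (at s)"
    by (rule has_vector_derivative_transform_within_open
        [OF has_vector_derivative_const[of c] \<open>open I\<close> \<open>s \<in> I\<close>]) (simp add: assms(3))
  ultimately show ?thesis
    by (rule vector_derivative_unique_at)
qed

lemma frenet_curve_differentiable:
  assumes "open I" "frenet_curve I \<alpha>" "s \<in> I"
  shows "(tangent \<alpha> has_vector_derivative vderiv (vderiv \<alpha>) s) (at s)"
    and "normal \<alpha> differentiable at s"
proof -
  have sm: "(vderiv ^^ n) \<alpha> differentiable at s" for n
    using assms by (auto simp: frenet_curve_def smooth_on_def differentiable_on_eq_differentiable_at)
  have d1: "vderiv \<alpha> differentiable at s"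
    using sm[of 1] by simp
  have d2: "vderiv (vderiv \<alpha>) differentiable at s"
    using sm[of 2] by (simp add: numeral_2_eq_2)
  have tan: "tangent \<alpha> = vderiv \<alpha>"
    by (auto simp: tangent_def)
  show "(tangent \<alpha> has_vector_derivative vderiv (vderiv \<alpha>) s) (at s)"
    using d1 by (simp add: tan vderiv_def[of "vderiv \<alpha>"] vector_derivative_works)
  have nz: "curvature \<alpha> s \<noteq> 0"
    using assms by (simp add: frenet_curve_def)
  have "(\<lambda>x. norm (vderiv (vderiv \<alpha>) x)) differentiable at s"
    using nz by (intro differentiable_compose[OF _ d2]) (simp add: curvature_def)
  then have "curvature \<alpha> differentiable at s"
    by (simp add: curvature_def[abs_def])
  then have "(\<lambda>x. vderiv (vderiv \<alpha>) x /\<^sub>R curvature \<alpha> x) differentiable at s"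
    using nz d2 by (intro differentiable_scaleR differentiable_inverse)
  then show "normal \<alpha> differentiable at s"
    by (simp add: normal_def[abs_def])
qed

lemma frenet_frame_orthonormal:
  assumes "open I" "frenet_curve I \<alpha>" "s \<in> I"
  shows "norm (tangent \<alpha> s) = 1" and "norm (normal \<alpha> s) = 1" and "tangent \<alpha> s \<bullet> normal \<alpha> s = 0"
proof -
  have unit: "norm (tangent \<alpha> x) = 1" if "x \<in> I" for x
    using assms that by (simp add: frenet_curve_def tangent_def)
  then show "norm (tangent \<alpha> s) = 1"
    using assms by simp
  have nz: "curvature \<alpha> s \<noteq> 0"
    using assms by (simp add: frenet_curve_def)
  then show "norm (normal \<alpha> s) = 1"
    by (simp add: normal_def curvature_def)
  note T' = frenet_curve_differentiable(1)[OF assms]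
  \<comment> \<open>The tangent has constant length, so its derivative is orthogonal to it.\<close>
  have "tangent \<alpha> s \<bullet> vderiv (vderiv \<alpha>) s = 0"
    using inner_constant_derivative[OF assms(1,3) _ T' T', of 1] unit
    by (simp add: dot_square_norm inner_commute)
  then show "tangent \<alpha> s \<bullet> normal \<alpha> s = 0"
    by (simp add: normal_def)
qed

lemma binormal_unit_orthogonal:
  assumes "open I" "frenet_curve I \<alpha>" "s \<in> I"
  shows "norm (binormal \<alpha> s) = 1" and "binormal \<alpha> s \<bullet> tangent \<alpha> s = 0"
    and "binormal \<alpha> s \<bullet> normal \<alpha> s = 0"
  using cross3_orthonormal(1)[OF frenet_frame_orthonormal[OF assms]]
  by (simp_all add: binormal_def dot_cross_self inner_commute)

lemma frenet_tangent_derivative: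
  assumes "open I" "frenet_curve I \<alpha>" "s \<in> I"
  shows "(tangent \<alpha> has_vector_derivative curvature \<alpha> s *\<^sub>R normal \<alpha> s) (at s)"
  using frenet_curve_differentiable(1)[OF assms] assms
  by (simp add: normal_def frenet_curve_def)

text \<open>
  The torsion is defined as a component of \<open>B'\<close> only. The other two vanish: \<open>B\<close> has constant
  length, and \<open>B \<bullet> T = 0\<close> gives \<open>B' \<bullet> T = - B \<bullet> T' = 0\<close>, as \<open>T'\<close> is a multiple of \<open>N\<close>.
\<close>

lemma frenet_binormal_derivative:
  assumes "open I" "frenet_curve I \<alpha>" "s \<in> I"
  shows "(binormal \<alpha> has_vector_derivative - torsion \<alpha> s *\<^sub>R normal \<alpha> s) (at s)"
proof -
  let ?T = "tangent \<alpha> s" and ?N = "normal \<alpha> s" and ?B = "binormal \<alpha> s"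
  let ?B' = "vderiv (binormal \<alpha>) s"
  note T' = frenet_tangent_derivative[OF assms]
  obtain N' where N': "(normal \<alpha> has_vector_derivative N') (at s)"
    using frenet_curve_differentiable(2)[OF assms] vector_derivative_works by blast
  have "bounded_bilinear cross3"
    using bilinear_cross bilinear_conv_bounded_bilinear by blast
  from bounded_bilinear.has_vector_derivative[OF this T' N']
  have "binormal \<alpha> differentiable at s"
    by (auto simp: binormal_def[abs_def] intro: differentiableI_vector)
  then have B': "(binormal \<alpha> has_vector_derivative ?B') (at s)"
    by (simp add: vderiv_def vector_derivative_works)
  have BB: "?B' \<bullet> ?B = 0"
    using inner_constant_derivative[OF assms(1,3) _ B' B', of 1]
      binormal_unit_orthogonal(1)[OF assms(1,2)]
    by (simp add: dot_square_norm inner_commute)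
  have BT: "?B' \<bullet> ?T = 0"
    using inner_constant_derivative[OF assms(1,3) _ B' T', of 0]
      binormal_unit_orthogonal[OF assms(1,2)] assms(3) by simp
  have "?B' = (?B' \<bullet> ?T) *\<^sub>R ?T + (?B' \<bullet> ?N) *\<^sub>R ?N + (?B' \<bullet> ?B) *\<^sub>R ?B"
    unfolding binormal_def[of \<alpha> s]
    by (rule orthonormal_frame_expansion[OF frenet_frame_orthonormal[OF assms]])
  then have "?B' = - torsion \<alpha> s *\<^sub>R ?N"
    by (simp add: BB BT torsion_def)
  then show ?thesis
    using B' by simp
qed

section \<open>The angle between curves with a common principal normal\<close>

lemma common_normal_imp_direction_angle:
  assumes "open I" "is_interval I" "I \<noteq> {}"
    and \<alpha>: "frenet_curve I \<alpha>" and \<beta>: "frenet_curve I \<beta>"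
    and N: "\<And>s. s \<in> I \<Longrightarrow> normal \<beta> s = normal \<alpha> s"
  shows "\<exists>\<theta>. direction_angle I \<alpha> \<beta> \<theta>"
proof -
  note frame\<alpha> = frenet_frame_orthonormal[OF \<open>open I\<close> \<alpha>]
    and frame\<beta> = frenet_frame_orthonormal[OF \<open>open I\<close> \<beta>]
    and b\<alpha> = binormal_unit_orthogonal[OF \<open>open I\<close> \<alpha>]
  have tN: "tangent \<beta> s \<bullet> normal \<alpha> s = 0" if "s \<in> I" for s
    using frame\<beta>(3)[OF that] N[OF that] by simp
  have "((\<lambda>x. tangent \<beta> x \<bullet> tangent \<alpha> x) has_vector_derivative 0) (at s within I)"
    if s: "s \<in> I" for s
    using bounded_bilinear.has_vector_derivative[OF bounded_bilinear_inner
        frenet_tangent_derivative[OF \<open>open I\<close> \<beta> s] frenet_tangent_derivative[OF \<open>open I\<close> \<alpha> s]]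
      tN[OF s] N[OF s] frame\<alpha>(3)[OF s]
    by (simp add: inner_commute has_vector_derivative_at_within)
  then obtain p where p: "\<And>s. s \<in> I \<Longrightarrow> tangent \<beta> s \<bullet> tangent \<alpha> s = p"
    using has_vector_derivative_zero_constant is_interval_convex[OF \<open>is_interval I\<close>] by blast
  have "((\<lambda>x. tangent \<beta> x \<bullet> binormal \<alpha> x) has_vector_derivative 0) (at s within I)"
    if s: "s \<in> I" for s
    using bounded_bilinear.has_vector_derivative[OF bounded_bilinear_inner
        frenet_tangent_derivative[OF \<open>open I\<close> \<beta> s] frenet_binormal_derivative[OF \<open>open I\<close> \<alpha> s]]
      tN[OF s] N[OF s] b\<alpha>(3)[OF s]
    by (simp add: inner_commute has_vector_derivative_at_within)
  then obtain q where q: "\<And>s. s \<in> I \<Longrightarrow> tangent \<beta> s \<bullet> binormal \<alpha> s = q"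
    using has_vector_derivative_zero_constant is_interval_convex[OF \<open>is_interval I\<close>] by blast
  have eq: "tangent \<beta> s = p *\<^sub>R tangent \<alpha> s + q *\<^sub>R binormal \<alpha> s" if s: "s \<in> I" for s
    using orthonormal_frame_expansion[OF frame\<alpha>[OF s], of "tangent \<beta> s"]
      p[OF s] q[OF s] tN[OF s]
    by (simp add: binormal_def)
  obtain s where s: "s \<in> I"
    using \<open>I \<noteq> {}\<close> by blast
  have "1 = tangent \<beta> s \<bullet> tangent \<beta> s"
    using frame\<beta>(1)[OF s] by (simp add: dot_square_norm)
  also have "\<dots> = tangent \<beta> s \<bullet> (p *\<^sub>R tangent \<alpha> s + q *\<^sub>R binormal \<alpha> s)"
    using eq[OF s] by simp
  also have "\<dots> = p\<^sup>2 + q\<^sup>2"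
    by (simp add: inner_add_right p[OF s] q[OF s] power2_eq_square)
  finally have "p\<^sup>2 + q\<^sup>2 = 1"
    by simp
  then obtain \<theta> where "p = cos \<theta>" "q = sin \<theta>"
    using sincos_total_2pi by metis
  then show ?thesis
    using eq by (auto simp: direction_angle_def tangent_def)
qed

lemma direction_angle_unique:
  assumes "open I" "I \<noteq> {}" and \<alpha>: "frenet_curve I \<alpha>"
    and \<theta>: "direction_angle I \<alpha> \<beta> \<theta>" and \<phi>: "direction_angle I \<alpha> \<beta> \<phi>"
  shows "\<exists>k::int. \<phi> = \<theta> + 2 * pi * of_int k"
proof -
  obtain s where s: "s \<in> I"
    using \<open>I \<noteq> {}\<close> by blast
  have comp: "vderiv \<beta> s \<bullet> tangent \<alpha> s = cos \<psi>" "vderiv \<beta> s \<bullet> binormal \<alpha> s = sin \<psi>"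
    if "direction_angle I \<alpha> \<beta> \<psi>" for \<psi>
    using that s frenet_frame_orthonormal(1)[OF \<open>open I\<close> \<alpha> s]
      binormal_unit_orthogonal[OF \<open>open I\<close> \<alpha> s]
    by (simp_all add: direction_angle_def inner_add_left dot_square_norm
        inner_commute[of "tangent \<alpha> s" "binormal \<alpha> s"])
  have "sin \<phi> = sin \<theta> \<and> cos \<phi> = cos \<theta>"
    using comp[OF \<theta>] comp[OF \<phi>] by simp
  then show ?thesis
    using sin_cos_eq_iff by auto
qed

section \<open>Transformation of curvature and torsion\<close>

lemma common_normal_curvature_torsion:
  assumes "open I" and \<alpha>: "frenet_curve I \<alpha>" and \<beta>: "frenet_curve I \<beta>"
    and N: "\<And>s. s \<in> I \<Longrightarrow> normal \<beta> s = normal \<alpha> s"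
    and \<theta>: "direction_angle I \<alpha> \<beta> \<theta>" and s: "s \<in> I"
  shows "curvature \<beta> s = curvature \<alpha> s * cos \<theta> - torsion \<alpha> s * sin \<theta>"
    and "torsion \<beta> s = curvature \<alpha> s * sin \<theta> + torsion \<alpha> s * cos \<theta>"
proof -
  let ?N = "normal \<alpha> s"
  have N0: "?N \<noteq> 0"
    using frenet_frame_orthonormal(2)[OF \<open>open I\<close> \<alpha> s] by auto
  note T' = frenet_tangent_derivative[OF \<open>open I\<close> \<alpha> s]
    and B' = frenet_binormal_derivative[OF \<open>open I\<close> \<alpha> s]
  have tan: "tangent \<beta> x = cos \<theta> *\<^sub>R tangent \<alpha> x + sin \<theta> *\<^sub>R binormal \<alpha> x" if "x \<in> I" for x
    using \<theta> that by (simp add: direction_angle_def tangent_def)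
  have bin: "binormal \<beta> x = cos \<theta> *\<^sub>R binormal \<alpha> x - sin \<theta> *\<^sub>R tangent \<alpha> x" if x: "x \<in> I" for x
  proof -
    have "cross3 (binormal \<alpha> x) (normal \<alpha> x) = - tangent \<alpha> x"
      using cross3_orthonormal(2)[OF frenet_frame_orthonormal[OF \<open>open I\<close> \<alpha> x]]
      by (simp add: binormal_def)
    then show ?thesis
      unfolding binormal_def[of \<beta>] N[OF x] tan[OF x] cross_add_left cross_mult_left
      by (simp add: binormal_def[symmetric])
  qed
  have lin: "((\<lambda>x. a *\<^sub>R tangent \<alpha> x + b *\<^sub>R binormal \<alpha> x) has_vector_derivative
      (a * curvature \<alpha> s - b * torsion \<alpha> s) *\<^sub>R ?N) (at s)" for a b
    using has_vector_derivative_add[OF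
        bounded_linear.has_vector_derivative[OF bounded_linear_scaleR_right[of a] T']
        bounded_linear.has_vector_derivative[OF bounded_linear_scaleR_right[of b] B']]
    by (simp add: scaleR_left_diff_distrib)
  have "(tangent \<beta> has_vector_derivative
      (cos \<theta> * curvature \<alpha> s - sin \<theta> * torsion \<alpha> s) *\<^sub>R ?N) (at s)"
    by (rule has_vector_derivative_transform_within_open[OF lin \<open>open I\<close> s]) (simp add: tan)
  from vector_derivative_unique_at[OF this frenet_tangent_derivative[OF \<open>open I\<close> \<beta> s]]
  show "curvature \<beta> s = curvature \<alpha> s * cos \<theta> - torsion \<alpha> s * sin \<theta>"
    using N0 by (simp add: N[OF s] mult.commute)
  have "(binormal \<beta> has_vector_derivative
      (- sin \<theta> * curvature \<alpha> s - cos \<theta> * torsion \<alpha> s) *\<^sub>R ?N) (at s)"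
    by (rule has_vector_derivative_transform_within_open[OF lin \<open>open I\<close> s]) (simp add: bin)
  from vector_derivative_unique_at[OF this frenet_binormal_derivative[OF \<open>open I\<close> \<beta> s]]
  have "- sin \<theta> * curvature \<alpha> s - cos \<theta> * torsion \<alpha> s = - torsion \<beta> s"
    using N0 by (simp only: N[OF s] scaleR_cancel_right) simp
  then show "torsion \<beta> s = curvature \<alpha> s * sin \<theta> + torsion \<alpha> s * cos \<theta>"
    by (simp add: algebra_simps)
qed

lemma rotate_pair_inverse:
  fixes k t \<theta> :: real
  assumes "k' = k * cos \<theta> - t * sin \<theta>" and "t' = k * sin \<theta> + t * cos \<theta>"
  shows "k = k' * cos \<theta> + t' * sin \<theta>" and "t = t' * cos \<theta> - k' * sin \<theta>"
proof -
  have "k' * cos \<theta> + t' * sin \<theta> = k * ((sin \<theta>)\<^sup>2 + (cos \<theta>)\<^sup>2)"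
    unfolding assms by algebra
  then show "k = k' * cos \<theta> + t' * sin \<theta>"
    by simp
  have "t' * cos \<theta> - k' * sin \<theta> = t * ((sin \<theta>)\<^sup>2 + (cos \<theta>)\<^sup>2)"
    unfolding assms by algebra
  then show "t = t' * cos \<theta> - k' * sin \<theta>"
    by simp
qed

theorem theorem5p5:
  fixes I :: "real set" and \<alpha> \<beta> :: "real \<Rightarrow> real^3"
  assumes "open I" and "is_interval I" and "I \<noteq> {}"
    and "frenet_curve I \<alpha>"
    and "bertrand_direction_curve I \<alpha> \<beta>"
  shows "(\<exists>\<theta>. direction_angle I \<alpha> \<beta> \<theta>) \<and>
    (\<forall>\<theta> \<phi>. direction_angle I \<alpha> \<beta> \<theta> \<and> direction_angle I \<alpha> \<beta> \<phi> \<longrightarrow>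
       (\<exists>k::int. \<phi> = \<theta> + 2 * pi * of_int k)) \<and>
    (\<forall>\<theta>. direction_angle I \<alpha> \<beta> \<theta> \<longrightarrow>
       (\<forall>s\<in>I.
          curvature \<beta> s = \<bar>curvature \<alpha> s * cos \<theta> - torsion \<alpha> s * sin \<theta>\<bar> \<and>
          torsion \<beta> s = curvature \<alpha> s * sin \<theta> + torsion \<alpha> s * cos \<theta> \<and>
          curvature \<alpha> s = \<bar>curvature \<beta> s * cos \<theta> + torsion \<beta> s * sin \<theta>\<bar> \<and>
          torsion \<alpha> s = torsion \<beta> s * cos \<theta> - curvature \<beta> s * sin \<theta>))"
proof -
  have \<beta>: "frenet_curve I \<beta>" and N: "\<And>s. s \<in> I \<Longrightarrow> normal \<beta> s = normal \<alpha> s"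
    using assms(5) by (auto simp: bertrand_direction_curve_def bertrand_curve_of_def)
  have formulas: "curvature \<beta> s = \<bar>curvature \<alpha> s * cos \<theta> - torsion \<alpha> s * sin \<theta>\<bar> \<and>
      torsion \<beta> s = curvature \<alpha> s * sin \<theta> + torsion \<alpha> s * cos \<theta> \<and>
      curvature \<alpha> s = \<bar>curvature \<beta> s * cos \<theta> + torsion \<beta> s * sin \<theta>\<bar> \<and>
      torsion \<alpha> s = torsion \<beta> s * cos \<theta> - curvature \<beta> s * sin \<theta>"
    if \<theta>: "direction_angle I \<alpha> \<beta> \<theta>" and s: "s \<in> I" for \<theta> s
  proof -
    note kt = common_normal_curvature_torsion[OF assms(1,4) \<beta> N \<theta> s]
    note inv = rotate_pair_inverse[OF kt]
    \<comment> \<open>The absolute values act on expressions equal to a curvature, that is, to a norm.\<close>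
    have "0 \<le> curvature \<alpha> s" "0 \<le> curvature \<beta> s"
      by (simp_all add: curvature_def)
    then show ?thesis
      using kt inv by (metis abs_of_nonneg)
  qed
  show ?thesis
    using common_normal_imp_direction_angle[OF assms(1-4) \<beta> N]
      direction_angle_unique[OF assms(1,3,4)] formulas by blast
qed

end
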